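(* Let $n \ge 2$ be an integer. There exists a subcubic tree of order $n$ that is both transmission irregular (TI) and edge transmission irregular (ETI) if and only if $n \in \{9, 11, 13\}$ or $n \ge 15$.
   Context: All graphs are finite, simple and undirected. The order of a graph is its number of vertices. For a connected graph $G$ and $v \in V(G)$, the transmission of $v$ is $\mathrm{Tr}_G(v) = \sum_{u \in V(G)} d_G(v,u)$, where $d_G$ is the shortest-path distance. For an edge $e = uv \in E(G)$, the transmission of $e$ is $\mathrm{Tr}_G(e) = \mathrm{Tr}_G(u) + \mathrm{Tr}_G(v)$. A connected graph $G$ is transmission irregular (TI) if any two distinct vertices of $G$ have different transmissions, and edge transmission irregular (ETI) if any two distinct edges of $G$ have different transmissions. A tree is subcubic if its maximum degree is at most $3$. *)

theory Defs
  imports Main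
begin

text \<open>A graph is given by a vertex set \<open>V\<close> and a set \<open>E\<close> of edges, an edge being
  the two-element set of its ends.\<close>

definition simple_graph :: "'a set \<Rightarrow> 'a set set \<Rightarrow> bool" where
  "simple_graph V E \<longleftrightarrow> finite V \<and> (\<forall>e\<in>E. e \<subseteq> V \<and> card e = 2)"

text \<open>Paths and cycles are lists of vertices; a path on the list \<open>p\<close> has
  \<open>length p - 1\<close> edges.\<close>

definition path_between :: "'a set \<Rightarrow> 'a set set \<Rightarrow> 'a \<Rightarrow> 'a list \<Rightarrow> 'a \<Rightarrow> bool" where
  "path_between V E u p v \<longleftrightarrow>
     p \<noteq> [] \<and> hd p = u \<and> last p = v \<and> set p \<subseteq> V \<and> distinct p \<and>
     successively (\<lambda>x y. {x, y} \<in> E) p"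

definition cycle_in :: "'a set \<Rightarrow> 'a set set \<Rightarrow> 'a list \<Rightarrow> bool" where
  "cycle_in V E c \<longleftrightarrow>
     length c \<ge> 3 \<and> set c \<subseteq> V \<and> distinct c \<and>
     successively (\<lambda>x y. {x, y} \<in> E) c \<and> {last c, hd c} \<in> E"

definition connected_graph :: "'a set \<Rightarrow> 'a set set \<Rightarrow> bool" where
  "connected_graph V E \<longleftrightarrow>
     simple_graph V E \<and> V \<noteq> {} \<and> (\<forall>u\<in>V. \<forall>v\<in>V. \<exists>p. path_between V E u p v)"

definition tree :: "'a set \<Rightarrow> 'a set set \<Rightarrow> bool" where
  "tree V E \<longleftrightarrow> connected_graph V E \<and> (\<nexists>c. cycle_in V E c)"

definition degree :: "'a set set \<Rightarrow> 'a \<Rightarrow> nat" where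
  "degree E v = card {e \<in> E. v \<in> e}"

definition max_degree :: "'a set \<Rightarrow> 'a set set \<Rightarrow> nat" where
  "max_degree V E = Max (degree E ` V)"

definition subcubic_tree :: "'a set \<Rightarrow> 'a set set \<Rightarrow> bool" where
  "subcubic_tree V E \<longleftrightarrow> tree V E \<and> max_degree V E \<le> 3"

text \<open>The distance is meaningful only for vertices joined by a path; it is used for connected
  graphs only.\<close>

definition distance :: "'a set \<Rightarrow> 'a set set \<Rightarrow> 'a \<Rightarrow> 'a \<Rightarrow> nat" where
  "distance V E u v = (LEAST k. \<exists>p. path_between V E u p v \<and> k = length p - 1)"

definition transmission :: "'a set \<Rightarrow> 'a set set \<Rightarrow> 'a \<Rightarrow> nat" where
  "transmission V E v = (\<Sum>u\<in>V. distance V E v u)"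

text \<open>For an edge \<open>e = {u, v}\<close> this sum has exactly the two terms belonging to \<open>u\<close> and \<open>v\<close>.\<close>

definition edge_transmission :: "'a set \<Rightarrow> 'a set set \<Rightarrow> 'a set \<Rightarrow> nat" where
  "edge_transmission V E e = (\<Sum>v\<in>e. transmission V E v)"

definition transmission_irregular :: "'a set \<Rightarrow> 'a set set \<Rightarrow> bool" where
  "transmission_irregular V E \<longleftrightarrow>
     connected_graph V E \<and>
     (\<forall>u\<in>V. \<forall>v\<in>V. u \<noteq> v \<longrightarrow> transmission V E u \<noteq> transmission V E v)"

definition edge_transmission_irregular :: "'a set \<Rightarrow> 'a set set \<Rightarrow> bool" where
  "edge_transmission_irregular V E \<longleftrightarrow>
     connected_graph V E \<and>
     (\<forall>e\<in>E. \<forall>f\<in>E. e \<noteq> f \<longrightarrow> edge_transmission V E e \<noteq> edge_transmission V E f)"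

end

theory Submission
  imports Defs "HOL-Library.Multiset"
begin

text \<open>
  Root a tree of order \<open>n\<close> at any vertex. Along an edge from a vertex \<open>u\<close> down to a child \<open>v\<close>
  whose subtree has \<open>s\<close> vertices, the transmission grows by \<open>n - 2 s\<close>, because moving from \<open>u\<close>
  to \<open>v\<close> brings \<open>s\<close> vertices nearer by one and takes the other \<open>n - s\<close> farther by one. So all
  differences of transmissions, hence both kinds of irregularity, can be read off the sizes of
  the subtrees. This turns the theorem into a statement about a datatype of rooted trees:
  \<open>irregular_forest_iff\<close> together with \<open>tree_represented\<close> and \<open>represents_exists\<close>.

  For the orders excluded by the theorem, the tree is rooted at a vertex of least transmission. If
  all transmissions differ, every subtree hanging from the root has fewer than \<open>n/2\<close> vertices, and
  no two subtrees hanging from the same vertex have the same size. Very few shapes remain for the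
  ten orders in question, and every one of them repeats a transmission of a vertex or of
  an edge (\<open>no_irregular_tree\<close>, \<open>excluded_orders\<close>).

  For the other orders, three long legs are joined at the root, and up to three leaves are hung on
  the first vertices of the first two legs. A hung leaf leaves one vertex less for the rest of its
  leg, so that all later increments on this leg grow by 2. With \<open>m\<close> about \<open>n/3\<close>, the \<open>u\<close>-th
  vertices of the legs have relative transmissions \<open>a u\<close>, \<open>b u\<close>, \<open>c u\<close>, which for \<open>u \<ge> 2\<close> are of the
  form \<open>u m + u^2 + k u + const\<close>. The leaves are chosen so that the first two legs have the same
  \<open>k\<close>, whereas the third has \<open>k + 2\<close>, and this is also the coefficient that belongs to
  \<open>a (u + 1)\<close>. Thus \<open>b u - a u\<close> and \<open>a (u + 1) - c u\<close> do not depend on \<open>u\<close>, both are positive, and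
  \<open>c u - b u\<close> is positive as well. The three sequences therefore interleave throughout,
  \<open>a u < b u < c u < a (u + 1)\<close>, and no number-theoretic coincidence can occur. The edges behave in
  the same way. The hung leaves have relative transmissions near multiples of \<open>m\<close> and fall into
  gaps of the sequences once \<open>m\<close> is large enough. One such family serves each residue class of \<open>n\<close>
  modulo 3; the orders up to 90 for which \<open>m\<close> is too small get individual trees.
\<close>

section \<open>Unique paths and joining two graphs by an edge\<close>

text \<open>Uniqueness of paths is the form of being a tree that is used for constructed graphs: it is
  inherited when two graphs are joined by an edge, and it makes every path a shortest one.\<close>

definition unique_paths :: "'a set \<Rightarrow> 'a set set \<Rightarrow> bool" where
  "unique_paths V E \<longleftrightarrow> (\<forall>x\<in>V. \<forall>y\<in>V. \<exists>!p. path_between V E x p y)"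

lemma path_between_self:
  assumes "path_between V E x p x" shows "p = [x]"
proof (cases p)
  case Nil
  with assms show ?thesis by (simp add: path_between_def)
next
  case (Cons z q)
  from assms have "hd p = x" "last p = x" "distinct p" unfolding path_between_def by blast+
  with Cons have "z = x" "q \<noteq> [] \<Longrightarrow> last q = x" "x \<notin> set q" by auto
  with Cons show ?thesis using last_in_set by blast
qed

lemma distance_unique_path:
  assumes "unique_paths V E" "x \<in> V" "y \<in> V" "path_between V E x p y"
  shows "distance V E x y = length p - 1"
  unfolding distance_def
proof (rule Least_equality)
  show "\<exists>q. path_between V E x q y \<and> length p - 1 = length q - 1" using assms by blast
next
  fix k assume "\<exists>q. path_between V E x q y \<and> k = length q - 1"
  with assms show "length p - 1 \<le> k" unfolding unique_paths_def by blast
qed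

lemma distance_self:
  assumes "x \<in> V" shows "distance V E x x = 0"
proof -
  have "path_between V E x [x] x" using assms by (simp add: path_between_def)
  then show ?thesis unfolding distance_def by (intro Least_eq_0) force
qed

lemma unique_paths_tree:
  assumes "simple_graph V E" "V \<noteq> {}" "unique_paths V E"
  shows "tree V E"
proof -
  have "\<not> cycle_in V E c" for c
  proof
    assume c: "cycle_in V E c"
    then have len: "length c \<ge> 3" and sub: "set c \<subseteq> V" and dc: "distinct c"
      and closed: "{hd c, last c} \<in> E"
      unfolding cycle_in_def by (simp_all add: insert_commute)
    from len have ne: "c \<noteq> []" by auto
    with sub have hl: "hd c \<in> V" "last c \<in> V" by (meson hd_in_set last_in_set subsetD)+
    have "hd c \<noteq> last c"
      using dc len by (cases c) (auto dest: last_in_set)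
    \<comment> \<open>The closing edge of a cycle is a second path between the ends of the rest.\<close>
    then have "path_between V E (hd c) [hd c, last c] (last c)"
      using closed hl by (simp add: path_between_def)
    moreover have "path_between V E (hd c) c (last c)"
      using c ne unfolding path_between_def cycle_in_def by blast
    ultimately have "c = [hd c, last c]" using assms(3) hl unfolding unique_paths_def by blast
    then have "length c = length [hd c, last c]" by (rule arg_cong)
    with len show False by simp
  qed
  moreover have "connected_graph V E"
    using assms unfolding connected_graph_def unique_paths_def by blast
  ultimately show ?thesis unfolding tree_def by blast
qed

definition bridge :: "'a set \<Rightarrow> 'a set set \<Rightarrow> 'a \<Rightarrow> 'a set \<Rightarrow> 'a set set \<Rightarrow> 'a \<Rightarrow> bool" where
  "bridge V1 E1 a V2 E2 b \<longleftrightarrow>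
     simple_graph V1 E1 \<and> simple_graph V2 E2 \<and> V1 \<inter> V2 = {} \<and> a \<in> V1 \<and> b \<in> V2"

text \<open>The edges of the graph obtained from two disjoint graphs by adding the edge between \<open>a\<close> and \<open>b\<close>;
  its vertex set is the union of the two.\<close>

abbreviation (input) bridged :: "'a set set \<Rightarrow> 'a \<Rightarrow> 'a set set \<Rightarrow> 'a \<Rightarrow> 'a set set" where
  "bridged E1 a E2 b \<equiv> insert {a, b} (E1 \<union> E2)"

lemma bridge_commute: "bridge V1 E1 a V2 E2 b \<Longrightarrow> bridge V2 E2 b V1 E1 a"
  unfolding bridge_def by blast

lemma bridged_commute: "bridged E1 a E2 b = bridged E2 b E1 a"
  by (simp add: insert_commute Un_commute)

lemma bridged_edge_cases:
  assumes "bridge V1 E1 a V2 E2 b" "{x, y} \<in> bridged E1 a E2 b" "x \<in> V1"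
  shows "y \<in> V1 \<and> {x, y} \<in> E1 \<or> x = a \<and> y = b"
proof -
  from assms(1) have sides: "\<forall>e\<in>E1. e \<subseteq> V1" "\<forall>e\<in>E2. e \<subseteq> V2" "V1 \<inter> V2 = {}" "b \<in> V2"
    unfolding bridge_def simple_graph_def by simp_all
  from sides(2) have "x \<in> V2" if "{x, y} \<in> E2" using that by fastforce
  with sides(3,4) assms(3) have x: "{x, y} \<notin> E2" "x \<noteq> b" by auto
  from assms(2) x(1) consider "{x, y} = {a, b}" | "{x, y} \<in> E1" by blast
  then show ?thesis
  proof cases
    case 1
    with x(2) show ?thesis by (simp add: doubleton_eq_iff)
  next
    case 2
    with sides(1) show ?thesis by blast
  qed
qed

lemma simple_graph_bridged:
  assumes "bridge V1 E1 a V2 E2 b"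
  shows "simple_graph (V1 \<union> V2) (bridged E1 a E2 b)"
proof -
  have "a \<noteq> b" using assms unfolding bridge_def by blast
  with assms show ?thesis unfolding bridge_def simple_graph_def by auto
qed

definition path_on :: "'a set \<Rightarrow> 'a set set \<Rightarrow> 'a list \<Rightarrow> bool" where
  "path_on V E p \<longleftrightarrow> p \<noteq> [] \<and> set p \<subseteq> V \<and> distinct p \<and> successively (\<lambda>x y. {x, y} \<in> E) p"

lemma path_between_path_on: "path_between V E x p y \<longleftrightarrow> path_on V E p \<and> hd p = x \<and> last p = y"
  unfolding path_between_def path_on_def by blast

lemma path_on_Cons:
  "path_on V E (x # p) \<longleftrightarrow> x \<in> V \<and> (p = [] \<or> path_on V E p \<and> x \<notin> set p \<and> {x, hd p} \<in> E)"
  unfolding path_on_def by (cases p) auto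

text \<open>A path can use the bridge only once, since it would otherwise visit an end of it twice.\<close>

lemma path_on_bridged_cases:
  assumes "bridge V1 E1 a V2 E2 b" "path_on (V1 \<union> V2) (bridged E1 a E2 b) p" "hd p \<in> V1"
  shows "path_on V1 E1 p \<or>
    (\<exists>p1 p2. p = p1 @ p2 \<and> path_on V1 E1 p1 \<and> last p1 = a \<and> path_on V2 E2 p2 \<and> hd p2 = b)"
  using assms
proof (induction p arbitrary: V1 E1 a V2 E2 b)
  case Nil
  then show ?case by (simp add: path_on_def)
next
  case (Cons x p)
  show ?case
  proof (cases "p = []")
    case True
    with Cons.prems show ?thesis by (simp add: path_on_def)
  next
    case False
    from Cons.prems(2) False have p: "path_on (V1 \<union> V2) (bridged E1 a E2 b) p"
      and x: "x \<notin> set p" and e: "{x, hd p} \<in> bridged E1 a E2 b"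
      by (simp_all add: path_on_Cons)
    from Cons.prems(3) have xV: "x \<in> V1" by simp
    from bridged_edge_cases[OF Cons.prems(1) e xV] show ?thesis
    proof
      assume h: "hd p \<in> V1 \<and> {x, hd p} \<in> E1"
      from Cons.IH[OF Cons.prems(1) p] h consider
        "path_on V1 E1 p" | p1 p2 where "p = p1 @ p2" "path_on V1 E1 p1" "last p1 = a"
          "path_on V2 E2 p2" "hd p2 = b"
        by blast
      then show ?thesis
      proof cases
        case 1
        then show ?thesis using x xV h by (simp add: path_on_Cons)
      next
        case 2
        then have "p1 \<noteq> []" by (simp add: path_on_def)
        with 2 x xV h have "path_on V1 E1 (x # p1)" "last (x # p1) = a" "x # p = (x # p1) @ p2"
          by (simp_all add: path_on_Cons)
        with 2 show ?thesis by blast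
      qed
    next
      assume h: "x = a \<and> hd p = b"
      have "hd p \<in> V2" using h Cons.prems(1) by (simp add: bridge_def)
      moreover have "path_on (V2 \<union> V1) (bridged E2 b E1 a) p"
        using p by (simp add: insert_commute Un_commute)
      ultimately have "path_on V2 E2 p \<or> (\<exists>p1 p2. p = p1 @ p2 \<and> path_on V1 E1 p2 \<and> hd p2 = a)"
        using Cons.IH[OF bridge_commute[OF Cons.prems(1)]] by blast
      moreover have False if "p = p1 @ p2" "path_on V1 E1 p2" "hd p2 = a" for p1 p2
        using that x h by (cases p2) (auto simp: path_on_def)
      moreover have "path_on V1 E1 [x]" using xV by (simp add: path_on_def)
      ultimately show ?thesis using h by (metis append_Cons append_Nil last_ConsL)
    qed
  qed
qed

lemma path_on_mono: "path_on V E p \<Longrightarrow> V \<subseteq> W \<Longrightarrow> E \<subseteq> F \<Longrightarrow> path_on W F p"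
  unfolding path_on_def by (auto intro: successively_mono)

lemma path_on_append:
  assumes "path_on V E p" "path_on V E q" "set p \<inter> set q = {}" "{last p, hd q} \<in> E"
  shows "path_on V E (p @ q)"
  using assms unfolding path_on_def by (auto simp: successively_append_iff)

lemma path_within_side:
  assumes "bridge V1 E1 a V2 E2 b" "x \<in> V1" "y \<in> V1"
  shows "path_between (V1 \<union> V2) (bridged E1 a E2 b) x p y \<longleftrightarrow> path_between V1 E1 x p y"
proof
  assume p: "path_between (V1 \<union> V2) (bridged E1 a E2 b) x p y"
  have False if "p = p1 @ p2" "path_on V2 E2 p2" for p1 p2
  proof -
    have "last p \<in> V2" using that unfolding path_on_def by auto
    with p assms show False unfolding path_between_def bridge_def by auto
  qed
  with path_on_bridged_cases[OF assms(1), of p] p assms(2)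
  show "path_between V1 E1 x p y" unfolding path_between_path_on by blast
next
  assume "path_between V1 E1 x p y"
  then show "path_between (V1 \<union> V2) (bridged E1 a E2 b) x p y"
    unfolding path_between_path_on by (auto intro: path_on_mono)
qed

lemma path_across_bridge:
  assumes "bridge V1 E1 a V2 E2 b" "x \<in> V1" "y \<in> V2"
  shows "path_between (V1 \<union> V2) (bridged E1 a E2 b) x p y \<longleftrightarrow>
    (\<exists>p1 p2. p = p1 @ p2 \<and> path_between V1 E1 x p1 a \<and> path_between V2 E2 b p2 y)"
proof
  assume p: "path_between (V1 \<union> V2) (bridged E1 a E2 b) x p y"
  have "\<not> path_on V1 E1 p"
    using p assms unfolding path_between_def path_on_def bridge_def by (metis disjoint_iff last_in_set subsetD)
  with path_on_bridged_cases[OF assms(1), of p] p assms(2) obtain p1 p2 where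
    "p = p1 @ p2" "path_on V1 E1 p1" "last p1 = a" "path_on V2 E2 p2" "hd p2 = b"
    unfolding path_between_path_on by blast
  with p show "\<exists>p1 p2. p = p1 @ p2 \<and> path_between V1 E1 x p1 a \<and> path_between V2 E2 b p2 y"
    unfolding path_between_path_on by (metis hd_append2 last_appendR path_on_def)
next
  assume "\<exists>p1 p2. p = p1 @ p2 \<and> path_between V1 E1 x p1 a \<and> path_between V2 E2 b p2 y"
  then obtain p1 p2 where *: "p = p1 @ p2" "path_on V1 E1 p1" "hd p1 = x" "last p1 = a"
    "path_on V2 E2 p2" "hd p2 = b" "last p2 = y"
    unfolding path_between_path_on by blast
  then have ne: "p1 \<noteq> []" "p2 \<noteq> []" unfolding path_on_def by auto
  have "path_on (V1 \<union> V2) (bridged E1 a E2 b) (p1 @ p2)"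
  proof (rule path_on_append)
    show "set p1 \<inter> set p2 = {}" using * assms(1) unfolding path_on_def bridge_def by blast
  qed (use * in \<open>auto intro: path_on_mono\<close>)
  with * ne show "path_between (V1 \<union> V2) (bridged E1 a E2 b) x p y"
    unfolding path_between_path_on by simp
qed

lemma unique_paths_bridged_half:
  assumes "bridge V1 E1 a V2 E2 b" "unique_paths V1 E1" "unique_paths V2 E2" "x \<in> V1" "y \<in> V1 \<union> V2"
  shows "\<exists>!p. path_between (V1 \<union> V2) (bridged E1 a E2 b) x p y"
proof (cases "y \<in> V1")
  case True
  with assms show ?thesis by (simp add: path_within_side unique_paths_def)
next
  case False
  with assms have y: "y \<in> V2" by blast
  have "\<exists>!p. path_between V1 E1 x p a" "\<exists>!p. path_between V2 E2 b p y"
    using assms y unfolding unique_paths_def bridge_def by auto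
  then show ?thesis unfolding path_across_bridge[OF assms(1,4) y] by metis
qed

lemma unique_paths_bridged:
  assumes "bridge V1 E1 a V2 E2 b" "unique_paths V1 E1" "unique_paths V2 E2"
  shows "unique_paths (V1 \<union> V2) (bridged E1 a E2 b)"
proof -
  have "\<exists>!p. path_between (V1 \<union> V2) (bridged E1 a E2 b) x p y" if "x \<in> V2" "y \<in> V1 \<union> V2" for x y
    using unique_paths_bridged_half[OF bridge_commute[OF assms(1)] assms(3,2), of x y] that
    by (simp add: insert_commute Un_commute)
  with unique_paths_bridged_half[OF assms] show ?thesis unfolding unique_paths_def by blast
qed

lemma distance_within_side:
  assumes "bridge V1 E1 a V2 E2 b" "x \<in> V1" "y \<in> V1"
  shows "distance (V1 \<union> V2) (bridged E1 a E2 b) x y = distance V1 E1 x y"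
  unfolding distance_def path_within_side[OF assms] ..

lemma distance_across_bridge:
  assumes "bridge V1 E1 a V2 E2 b" "unique_paths V1 E1" "unique_paths V2 E2" "x \<in> V1" "y \<in> V2"
  shows "distance (V1 \<union> V2) (bridged E1 a E2 b) x y = distance V1 E1 x a + 1 + distance V2 E2 b y"
proof -
  have ab: "a \<in> V1" "b \<in> V2" using assms(1) unfolding bridge_def by auto
  obtain p q where p: "path_between V1 E1 x p a" and q: "path_between V2 E2 b q y"
    using assms ab unfolding unique_paths_def by blast
  then have "path_between (V1 \<union> V2) (bridged E1 a E2 b) x (p @ q) y"
    unfolding path_across_bridge[OF assms(1,4,5)] by blast
  from distance_unique_path[OF unique_paths_bridged[OF assms(1-3)] _ _ this]
    distance_unique_path[OF assms(2) assms(4) ab(1) p] distance_unique_path[OF assms(3) ab(2) assms(5) q]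
    p q assms(4,5) show ?thesis by (cases p; cases q) (auto simp: path_between_def)
qed

section \<open>Rooted trees as a datatype\<close>

text \<open>\<open>Plant c s\<close> consists of a first tree, whose root has the forest \<open>c\<close> of subtrees below it,
  followed by the forest \<open>s\<close>. A rooted tree is given by the forest below its root, so that its
  order is one more than the \<open>order\<close> of that forest.\<close>

datatype forest = Void | Plant forest forest

fun order :: "forest \<Rightarrow> int" where
  "order Void = 0"
| "order (Plant c s) = 1 + order c + order s"

fun width :: "forest \<Rightarrow> nat" where
  "width Void = 0"
| "width (Plant c s) = Suc (width s)"

text \<open>The bound is 2 because every vertex of the forest is also joined to its parent.\<close>

fun narrow :: "forest \<Rightarrow> bool" where
  "narrow Void = True"
| "narrow (Plant c s) \<longleftrightarrow> width c \<le> 2 \<and> narrow c \<and> narrow s"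

text \<open>The transmissions of the vertices of a forest, and those of the edges leading to them, in a tree of
  order \<open>n\<close> in which the common parent of the roots of the forest has transmission \<open>x\<close>. The
  increment \<open>n - 2 * (1 + order c)\<close> comes from the \<open>1 + order c\<close> vertices that get nearer by one
  on the way down to the root of the first tree, while all the others get farther by one.\<close>

fun vals :: "int \<Rightarrow> int \<Rightarrow> forest \<Rightarrow> int list" where
  "vals n x Void = []"
| "vals n x (Plant c s) =
    (let y = x + n - 2 * (1 + order c) in y # vals n y c @ vals n x s)"

fun evals :: "int \<Rightarrow> int \<Rightarrow> forest \<Rightarrow> int list" where
  "evals n x Void = []"
| "evals n x (Plant c s) =
    (let y = x + n - 2 * (1 + order c) in (x + y) # evals n y c @ evals n x s)"

lemma order_size: "order F = int (size F)"
  by (induction F) auto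

lemma vals_shift: "vals n (k + x) F = map ((+) (k)) (vals n x F)"
proof (induction F arbitrary: x)
  case (Plant c s)
  have "k + x + n - 2 * (1 + order c) = k + (x + n - 2 * (1 + order c))" by simp
  then show ?case by (simp only: vals.simps Let_def Plant.IH) simp
qed simp

lemma evals_shift: "evals n (k + x) F = map ((+) (2 * k)) (evals n x F)"
proof (induction F arbitrary: x)
  case (Plant c s)
  have "k + x + n - 2 * (1 + order c) = k + (x + n - 2 * (1 + order c))" by simp
  then show ?case by (simp only: evals.simps Let_def Plant.IH) simp
qed simp

text \<open>The graph on \<open>V\<close> and \<open>E\<close>, rooted at \<open>r\<close>, has the shape of the tree whose root carries the forest
  \<open>F\<close>. In the second rule the first tree of the forest, rooted at \<open>v\<close>, is joined to a
  tree that already has root \<open>r\<close>, so that one bridge is added at a time.\<close>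

inductive represents :: "'a \<Rightarrow> forest \<Rightarrow> 'a set \<Rightarrow> 'a set set \<Rightarrow> bool" where
  single: "represents r Void {r} {}"
| join: "\<lbrakk>represents v c V1 E1; represents r s V2 E2; V1 \<inter> V2 = {}\<rbrakk>
    \<Longrightarrow> represents r (Plant c s) (V1 \<union> V2) (bridged E1 v E2 r)"

lemma represents_graph:
  assumes "represents r F V E"
  shows "simple_graph V E \<and> r \<in> V \<and> unique_paths V E \<and> int (card V) = 1 + order F"
  using assms
proof induction
  case (single r)
  have "path_between {r} {} r [r] r" by (simp add: path_between_def)
  then have "unique_paths {r} {}" unfolding unique_paths_def by (metis path_between_self singletonD)
  then show ?case by (simp add: simple_graph_def)
next
  case (join v c V1 E1 r s V2 E2)
  then have b: "bridge V1 E1 v V2 E2 r" unfolding bridge_def by blast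
  with join have "card (V1 \<union> V2) = card V1 + card V2"
    by (auto simp: simple_graph_def intro: card_Un_disjoint)
  with join simple_graph_bridged[OF b] unique_paths_bridged[OF b] show ?case by simp
qed

lemma represents_bridge:
  assumes "represents v c V1 E1" "represents r s V2 E2" "V1 \<inter> V2 = {}"
  shows "bridge V1 E1 v V2 E2 r"
  using represents_graph[OF assms(1)] represents_graph[OF assms(2)] assms(3)
  unfolding bridge_def by blast

lemma represents_finite_edges: "represents r F V E \<Longrightarrow> finite E"
  by (induction rule: represents.induct) auto

text \<open>An induction over \<^const>\<open>represents\<close> has to speak about transmissions in the whole tree while
  looking at a part of it. All that matters of the rest is the number \<open>m\<close> of its vertices: if
  they are attached at \<open>r\<close>, then they contribute \<open>m\<close> times the distance to \<open>r\<close> and a constant.\<close>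

definition pull :: "'a set \<Rightarrow> 'a set set \<Rightarrow> int \<Rightarrow> 'a \<Rightarrow> 'a \<Rightarrow> int" where
  "pull V E m r x = int (transmission V E x) + m * int (distance V E x r)"

lemma pull_root: "r \<in> V \<Longrightarrow> pull V E m r r = int (transmission V E r)"
  by (simp add: pull_def distance_self)

lemma transmission_bridged:
  assumes "bridge V1 E1 a V2 E2 b" "unique_paths V1 E1" "unique_paths V2 E2" "x \<in> V1"
  shows "int (transmission (V1 \<union> V2) (bridged E1 a E2 b) x) =
    pull V1 E1 (int (card V2)) a x + int (card V2) + int (transmission V2 E2 b)"
proof -
  let ?d = "distance (V1 \<union> V2) (bridged E1 a E2 b)"
  from assms(1) have fin: "finite V1" "finite V2" "V1 \<inter> V2 = {}"
    unfolding bridge_def simple_graph_def by auto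
  have "transmission (V1 \<union> V2) (bridged E1 a E2 b) x = (\<Sum>y\<in>V1. ?d x y) + (\<Sum>y\<in>V2. ?d x y)"
    unfolding transmission_def by (rule sum.union_disjoint[OF fin])
  also have "(\<Sum>y\<in>V1. ?d x y) = transmission V1 E1 x"
    unfolding transmission_def using distance_within_side[OF assms(1,4)] by (intro sum.cong) auto
  also have "(\<Sum>y\<in>V2. ?d x y) = (\<Sum>y\<in>V2. (distance V1 E1 x a + 1) + distance V2 E2 b y)"
    using distance_across_bridge[OF assms] by (intro sum.cong) auto
  also have "\<dots> = card V2 * (distance V1 E1 x a + 1) + transmission V2 E2 b"
    unfolding transmission_def sum.distrib by simp
  finally show ?thesis by (simp add: pull_def algebra_simps)
qed

lemma pull_below_bridge:
  assumes "bridge V1 E1 v V2 E2 r" "unique_paths V1 E1" "unique_paths V2 E2" "x \<in> V1"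
  shows "pull (V1 \<union> V2) (bridged E1 v E2 r) m r x =
    (int (transmission V2 E2 r) + int (card V2) + m) + pull V1 E1 (int (card V2) + m) v x"
proof -
  have r: "r \<in> V2" using assms(1) by (simp add: bridge_def)
  show ?thesis
    unfolding pull_def[of "V1 \<union> V2"] transmission_bridged[OF assms] distance_across_bridge[OF assms r]
    by (simp add: pull_def distance_self[OF r] algebra_simps)
qed

lemma pull_beside_bridge:
  assumes "bridge V1 E1 v V2 E2 r" "unique_paths V1 E1" "unique_paths V2 E2" "x \<in> V2"
  shows "pull (V1 \<union> V2) (bridged E1 v E2 r) m r x =
    (int (transmission V1 E1 v) + int (card V1)) + pull V2 E2 (int (card V1) + m) r x"
proof -
  have r: "r \<in> V2" using assms(1) by (simp add: bridge_def)
  note b = bridge_commute[OF assms(1)]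
  have "pull (V1 \<union> V2) (bridged E1 v E2 r) m r x = pull (V2 \<union> V1) (bridged E2 r E1 v) m r x"
    by (simp only: bridged_commute Un_commute)
  also have "\<dots> = (int (transmission V1 E1 v) + int (card V1)) + pull V2 E2 (int (card V1) + m) r x"
    unfolding pull_def[of "V2 \<union> V1"] transmission_bridged[OF b assms(3,2,4)]
      distance_within_side[OF b assms(4) r]
    by (simp add: pull_def algebra_simps)
  finally show ?thesis .
qed

text \<open>Joining two parts puts each of them into the rest of the other: the \<open>m\<close> of the one grows by the order
  of the other, so that \<open>card V + m\<close> stays the order \<open>n\<close> of the whole tree.\<close>

lemma mset_pull:
  assumes "represents r F V E" "int (card V) + m = n"
  shows "image_mset (pull V E m r) (mset_set V) =
    mset (int (transmission V E r) # vals n (int (transmission V E r)) F)"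
  using assms
proof (induction arbitrary: m)
  case (single r)
  then show ?case by (simp add: pull_root)
next
  case (join v c V1 E1 r s V2 E2)
  let ?V = "V1 \<union> V2" and ?E = "bridged E1 v E2 r"
  let ?t1 = "int (transmission V1 E1 v)" and ?t2 = "int (transmission V2 E2 r)"
  note b = represents_bridge[OF join.hyps]
  note g1 = represents_graph[OF join.hyps(1)] and g2 = represents_graph[OF join.hyps(2)]
  have up: "unique_paths V1 E1" "unique_paths V2 E2" and fin: "finite V1" "finite V2"
    and v: "v \<in> V1" and r: "r \<in> V2" and c1: "int (card V1) = 1 + order c"
    using g1 g2 by (auto simp: simple_graph_def)
  have card: "int (card ?V) = int (card V1) + int (card V2)"
    using fin join.hyps(3) by (simp add: card_Un_disjoint)
  let ?k1 = "?t2 + int (card V2) + m" and ?k2 = "?t1 + int (card V1)"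
  have "image_mset (pull ?V ?E m r) (mset_set V1) =
      image_mset ((+) ?k1) (image_mset (pull V1 E1 (int (card V2) + m) v) (mset_set V1))"
    unfolding multiset.map_comp using pull_below_bridge[OF b up] fin
    by (intro image_mset_cong) simp
  also have "\<dots> = mset ((?k1 + ?t1) # vals n (?k1 + ?t1) c)"
    using join.IH(1)[of "int (card V2) + m"] join.prems card by (simp add: vals_shift)
  finally have 1: "image_mset (pull ?V ?E m r) (mset_set V1) = mset ((?k1 + ?t1) # vals n (?k1 + ?t1) c)" .
  have "image_mset (pull ?V ?E m r) (mset_set V2) =
      image_mset ((+) ?k2) (image_mset (pull V2 E2 (int (card V1) + m) r) (mset_set V2))"
    unfolding multiset.map_comp using pull_beside_bridge[OF b up] fin
    by (intro image_mset_cong) simp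
  also have "\<dots> = mset ((?k2 + ?t2) # vals n (?k2 + ?t2) s)"
    using join.IH(2)[of "int (card V1) + m"] join.prems card by (simp add: vals_shift)
  finally have 2: "image_mset (pull ?V ?E m r) (mset_set V2) = mset ((?k2 + ?t2) # vals n (?k2 + ?t2) s)" .
  have t: "int (transmission ?V ?E r) = ?k2 + ?t2"
    using pull_beside_bridge[OF b up r, of m] r by (simp add: pull_root)
  have y: "?k2 + ?t2 + n - 2 * (1 + order c) = ?k1 + ?t1"
    using c1 card join.prems by simp
  have "mset_set ?V = mset_set V1 + mset_set V2"
    using fin join.hyps(3) by (rule mset_set_Union)
  then show ?case unfolding vals.simps Let_def t y by (simp only: image_mset_union 1 2) simp
qed

lemma mset_edge_pull:
  assumes "represents r F V E" "int (card V) + m = n"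
  shows "image_mset (\<lambda>e. \<Sum>x\<in>e. pull V E m r x) (mset_set E) =
    mset (evals n (int (transmission V E r)) F)"
  using assms
proof (induction arbitrary: m)
  case (single r)
  then show ?case by simp
next
  case (join v c V1 E1 r s V2 E2)
  let ?V = "V1 \<union> V2" and ?E = "bridged E1 v E2 r"
  let ?t1 = "int (transmission V1 E1 v)" and ?t2 = "int (transmission V2 E2 r)"
  note b = represents_bridge[OF join.hyps]
  note g1 = represents_graph[OF join.hyps(1)] and g2 = represents_graph[OF join.hyps(2)]
  have up: "unique_paths V1 E1" "unique_paths V2 E2" and fin: "finite V1" "finite V2"
    and v: "v \<in> V1" and r: "r \<in> V2" and c1: "int (card V1) = 1 + order c"
    and e1: "\<And>e. e \<in> E1 \<Longrightarrow> e \<subseteq> V1 \<and> card e = 2" and e2: "\<And>e. e \<in> E2 \<Longrightarrow> e \<subseteq> V2 \<and> card e = 2"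
    using g1 g2 by (auto simp: simple_graph_def)
  have card: "int (card ?V) = int (card V1) + int (card V2)"
    using fin join.hyps(3) by (simp add: card_Un_disjoint)
  have finE: "finite E1" "finite E2"
    using join.hyps(1,2) by (auto intro: represents_finite_edges)
  let ?k1 = "?t2 + int (card V2) + m" and ?k2 = "?t1 + int (card V1)"
  let ?p = "\<lambda>e. \<Sum>x\<in>e. pull ?V ?E m r x"
  have sum1: "?p e = 2 * ?k1 + (\<Sum>x\<in>e. pull V1 E1 (int (card V2) + m) v x)" if "e \<in> E1" for e
  proof -
    have "?p e = (\<Sum>x\<in>e. ?k1 + pull V1 E1 (int (card V2) + m) v x)"
      using e1[OF that] pull_below_bridge[OF b up] by (intro sum.cong) auto
    then show ?thesis using e1[OF that] by (simp add: sum.distrib)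
  qed
  have sum2: "?p e = 2 * ?k2 + (\<Sum>x\<in>e. pull V2 E2 (int (card V1) + m) r x)" if "e \<in> E2" for e
  proof -
    have "?p e = (\<Sum>x\<in>e. ?k2 + pull V2 E2 (int (card V1) + m) r x)"
      using e2[OF that] pull_beside_bridge[OF b up] by (intro sum.cong) auto
    then show ?thesis using e2[OF that] by (simp add: sum.distrib)
  qed
  have "image_mset ?p (mset_set E1) = image_mset ((+) (2 * ?k1))
      (image_mset (\<lambda>e. \<Sum>x\<in>e. pull V1 E1 (int (card V2) + m) v x) (mset_set E1))"
    unfolding multiset.map_comp using sum1 finE by (intro image_mset_cong) simp
  also have "\<dots> = mset (evals n (?k1 + ?t1) c)"
    using join.IH(1)[of "int (card V2) + m"] join.prems card by (simp add: evals_shift)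
  finally have 1: "image_mset ?p (mset_set E1) = mset (evals n (?k1 + ?t1) c)" .
  have "image_mset ?p (mset_set E2) = image_mset ((+) (2 * ?k2))
      (image_mset (\<lambda>e. \<Sum>x\<in>e. pull V2 E2 (int (card V1) + m) r x) (mset_set E2))"
    unfolding multiset.map_comp using sum2 finE by (intro image_mset_cong) simp
  also have "\<dots> = mset (evals n (?k2 + ?t2) s)"
    using join.IH(2)[of "int (card V1) + m"] join.prems card by (simp add: evals_shift)
  finally have 2: "image_mset ?p (mset_set E2) = mset (evals n (?k2 + ?t2) s)" .
  have t: "int (transmission ?V ?E r) = ?k2 + ?t2"
    using pull_beside_bridge[OF b up r, of m] r by (simp add: pull_root)
  have y: "?k2 + ?t2 + n - 2 * (1 + order c) = ?k1 + ?t1"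
    using c1 card join.prems by simp
  have "v \<noteq> r" using v r join.hyps(3) by blast
  then have 3: "?p {v, r} = (?k2 + ?t2) + (?k1 + ?t1)"
    using pull_below_bridge[OF b up v, of m] pull_beside_bridge[OF b up r, of m] v r
    by (simp add: pull_root)
  have "{v, r} \<notin> E1 \<union> E2"
    using e1 e2 v r join.hyps(3) by blast
  moreover have "E1 \<inter> E2 = {}"
  proof -
    have False if "e \<in> E1" "e \<in> E2" for e
      using e1[OF that(1)] e2[OF that(2)] join.hyps(3) by (metis card.empty inf.bounded_iff subset_empty zero_neq_numeral)
    then show ?thesis by blast
  qed
  ultimately have "mset_set ?E = {#{v, r}#} + (mset_set E1 + mset_set E2)"
    using finE by (simp add: mset_set_Union)
  then show ?case unfolding evals.simps Let_def t y
    by (simp only: image_mset_union image_mset_single 1 2 3) simp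
qed

lemma inj_on_iff_distinct:
  assumes "image_mset f (mset_set A) = mset xs" "finite A"
  shows "inj_on f A \<longleftrightarrow> distinct xs"
proof -
  have "f ` A = set xs" using assms by (metis finite_set_mset_mset_set set_image_mset set_mset_mset)
  moreover have "card A = length xs" using assms by (metis size_image_mset size_mset size_mset_set)
  ultimately show ?thesis
    using assms(2) by (metis card_distinct distinct_card eq_card_imp_inj_on card_image)
qed

lemma irregular_iff_distinct:
  assumes "represents r F V E"
  defines "n \<equiv> 1 + order F"
  shows "transmission_irregular V E \<longleftrightarrow> distinct (0 # vals n 0 F)"
    and "edge_transmission_irregular V E \<longleftrightarrow> distinct (evals n 0 F)"
proof -
  note g = represents_graph[OF assms(1)]
  have conn: "connected_graph V E"
    using unique_paths_tree g unfolding tree_def by blast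
  have fin: "finite V" "finite E"
    using g represents_finite_edges[OF assms(1)] by (auto simp: simple_graph_def)
  have n: "int (card V) + 0 = n" using g n_def by simp
  let ?t = "int (transmission V E r)"
  have pull: "pull V E 0 r = (\<lambda>x. int (transmission V E x))" by (simp add: pull_def fun_eq_iff)
  have "transmission_irregular V E \<longleftrightarrow> inj_on (pull V E 0 r) V"
    unfolding transmission_irregular_def pull inj_on_def using conn by auto
  also have "\<dots> \<longleftrightarrow> distinct (?t # vals n (?t + 0) F)"
    using inj_on_iff_distinct[OF mset_pull[OF assms(1) n] fin(1)] by simp
  also have "?t # vals n (?t + 0) F = map ((+) ?t) (0 # vals n 0 F)"
    unfolding vals_shift by simp
  finally show "transmission_irregular V E \<longleftrightarrow> distinct (0 # vals n 0 F)"
    unfolding distinct_map by (simp add: inj_on_def)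
  have e: "(\<Sum>x\<in>e. pull V E 0 r x) = int (edge_transmission V E e)" for e
    by (simp add: pull edge_transmission_def)
  have "edge_transmission_irregular V E \<longleftrightarrow> inj_on (\<lambda>e. \<Sum>x\<in>e. pull V E 0 r x) E"
    unfolding edge_transmission_irregular_def e inj_on_def using conn by auto
  also have "\<dots> \<longleftrightarrow> distinct (evals n (?t + 0) F)"
    using inj_on_iff_distinct[OF mset_edge_pull[OF assms(1) n] fin(2)] by simp
  also have "evals n (?t + 0) F = map ((+) (2 * ?t)) (evals n 0 F)"
    unfolding evals_shift by simp
  finally show "edge_transmission_irregular V E \<longleftrightarrow> distinct (evals n 0 F)"
    unfolding distinct_map by (simp add: inj_on_def)
qed

section \<open>Trees and their representations\<close>

lemma simple_graph_finite_edges: "simple_graph V E \<Longrightarrow> finite E"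
  unfolding simple_graph_def by (meson Pow_iff finite_Pow_iff finite_subset subsetI)

lemma degree_bridged:
  assumes "bridge V1 E1 a V2 E2 b" "x \<in> V1"
  shows "degree (bridged E1 a E2 b) x = degree E1 x + (if x = a then 1 else 0)"
proof -
  from assms have s: "simple_graph V1 E1" "simple_graph V2 E2" "V1 \<inter> V2 = {}" "b \<in> V2"
    unfolding bridge_def by auto
  then have "x \<noteq> b" "\<forall>e\<in>E2. x \<notin> e" "{a, b} \<notin> E1"
    using assms(2) unfolding simple_graph_def by blast+
  then have "{e \<in> bridged E1 a E2 b. x \<in> e} =
      (if x = a then insert {a, b} {e \<in> E1. x \<in> e} else {e \<in> E1. x \<in> e})"
    by auto
  with \<open>{a, b} \<notin> E1\<close> simple_graph_finite_edges[OF s(1)] show ?thesis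
    unfolding degree_def by simp
qed

lemma represents_degree:
  assumes "represents r F V E"
  shows "degree E r = width F \<and> ((\<forall>x\<in>V - {r}. degree E x \<le> 3) \<longleftrightarrow> narrow F)"
  using assms
proof induction
  case (single r)
  show ?case by (simp add: degree_def)
next
  case (join v c V1 E1 r s V2 E2)
  let ?E = "bridged E1 v E2 r"
  note b = represents_bridge[OF join.hyps]
  have 1: "degree ?E x = degree E1 x + (if x = v then 1 else 0)" if "x \<in> V1" for x
    using degree_bridged[OF b that] .
  have 2: "degree ?E x = degree E2 x + (if x = r then 1 else 0)" if "x \<in> V2" for x
    using degree_bridged[OF bridge_commute[OF b] that] by (simp only: bridged_commute)
  have v: "v \<in> V1" and r: "r \<in> V2" "r \<notin> V1" using b unfolding bridge_def by auto
  then have V: "V1 \<union> V2 - {r} = insert v (V1 - {v}) \<union> (V2 - {r})" by blast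
  have "(\<forall>x\<in>V1 - {v}. degree ?E x \<le> 3) \<longleftrightarrow> narrow c"
    using join.IH(1) 1 by auto
  moreover have "(\<forall>x\<in>V2 - {r}. degree ?E x \<le> 3) \<longleftrightarrow> narrow s"
    using join.IH(2) 2 by auto
  moreover have "degree ?E v \<le> 3 \<longleftrightarrow> width c \<le> 2"
    using join.IH(1) 1[OF v] by auto
  moreover have "degree ?E r = Suc (width s)"
    using join.IH(2) 2[OF r(1)] by simp
  ultimately show ?case unfolding V ball_Un ball_simps by simp
qed

lemma max_degree_le_iff:
  assumes "finite V" "V \<noteq> {}"
  shows "max_degree V E \<le> k \<longleftrightarrow> (\<forall>x\<in>V. degree E x \<le> k)"
  unfolding max_degree_def using assms by (subst Max_le_iff) auto

lemma represents_subcubic: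
  assumes "represents r F V E"
  shows "subcubic_tree V E \<longleftrightarrow> width F \<le> 3 \<and> narrow F"
proof -
  note g = represents_graph[OF assms]
  then have V: "V = insert r (V - {r})" "finite V" "V \<noteq> {}" by (auto simp: simple_graph_def)
  have "tree V E" using g V unique_paths_tree by blast
  moreover have "(\<forall>x\<in>V. degree E x \<le> 3) \<longleftrightarrow> degree E r \<le> 3 \<and> (\<forall>x\<in>V - {r}. degree E x \<le> 3)"
    using V(1) by blast
  ultimately show ?thesis
    unfolding subcubic_tree_def max_degree_le_iff[OF V(2,3)] using represents_degree[OF assms] by simp
qed

lemma represents_exists: "\<exists>V E. represents k F V E \<and> V = {k..k + size F}" for k :: nat
proof (induction F arbitrary: k)
  case Void
  show ?case using represents.single[of k] by auto
next
  case (Plant c s)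
  from Plant.IH(2)[of k] obtain E2 where 2: "represents k s {k..k + size s} E2" by blast
  from Plant.IH(1)[of "k + size s + 1"] obtain E1 where
    1: "represents (k + size s + 1) c {k + size s + 1..k + size s + 1 + size c} E1" by blast
  have "{k + size s + 1..k + size s + 1 + size c} \<union> {k..k + size s} = {k..k + size (Plant c s)}"
    by auto
  with represents.join[OF 1 2] show ?case by (auto intro!: exI)
qed

text \<open>This is the induction step for \<open>tree_represented\<close>, where trees are built up leaf by leaf: the new
  leaf becomes a child of \<open>u\<close>, wherever in the forest \<open>u\<close> is.\<close>

lemma represents_add_leaf:
  assumes "represents r F V E" "u \<in> V" "w \<notin> V"
  shows "\<exists>F'. represents r F' (insert w V) (insert {u, w} E)"
  using assms
proof (induction)
  case (single r)
  with represents.join[OF represents.single[of w] represents.single[of r]]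
  show ?case by (auto simp: insert_commute)
next
  case (join v c V1 E1 r s V2 E2)
  show ?case
  proof (cases "u \<in> V1")
    case True
    with join obtain c' where "represents v c' (insert w V1) (insert {u, w} E1)" by auto
    from represents.join[OF this join.hyps(2)] join.hyps(3) join.prems
    have "represents r (Plant c' s) (insert w V1 \<union> V2) (bridged (insert {u, w} E1) v E2 r)" by auto
    moreover have "insert w V1 \<union> V2 = insert w (V1 \<union> V2)"
      "bridged (insert {u, w} E1) v E2 r = insert {u, w} (bridged E1 v E2 r)" by blast+
    ultimately show ?thesis by metis
  next
    case False
    with join obtain s' where "represents r s' (insert w V2) (insert {u, w} E2)" by auto
    from represents.join[OF join.hyps(1) this] join.hyps(3) join.prems
    have "represents r (Plant c s') (V1 \<union> insert w V2) (bridged E1 v (insert {u, w} E2) r)" by auto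
    moreover have "V1 \<union> insert w V2 = insert w (V1 \<union> V2)"
      "bridged E1 v (insert {u, w} E2) r = insert {u, w} (bridged E1 v E2 r)" by blast+
    ultimately show ?thesis by metis
  qed
qed

definition leaf_at :: "'a set set \<Rightarrow> 'a \<Rightarrow> 'a \<Rightarrow> bool" where
  "leaf_at E u w \<longleftrightarrow> {u, w} \<in> E \<and> u \<noteq> w \<and> (\<forall>x. {x, w} \<in> E \<longrightarrow> x = u)"

text \<open>The last vertex of a longest path from \<open>r\<close> is a leaf: a neighbour outside the path would
  prolong it, and a second neighbour on it would close a cycle.\<close>

lemma tree_has_leaf:
  assumes "tree V E" "r \<in> V" "V \<noteq> {r}"
  obtains u w where "u \<in> V" "w \<in> V" "w \<noteq> r" "leaf_at E u w"
proof -
  from assms have sg: "simple_graph V E" and conn: "connected_graph V E"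
    and acyc: "\<And>c. \<not> cycle_in V E c"
    unfolding tree_def connected_graph_def by blast+
  from sg have fin: "finite V" unfolding simple_graph_def by blast
  let ?P = "\<lambda>p. path_on V E p \<and> hd p = r"
  have bound: "length p \<le> card V" if "?P p" for p
    using that fin by (metis card_mono distinct_card path_on_def)
  obtain y where y: "y \<in> V" "y \<noteq> r" using assms by blast
  then obtain q where q: "path_on V E q" "hd q = r" "last q = y"
    using conn assms(2) unfolding connected_graph_def path_between_path_on by blast
  with y have "length q \<ge> 2"
    unfolding path_on_def by (cases q rule: remdups_adj.cases) auto
  have "\<exists>p. ?P p \<and> (\<forall>p'. ?P p' \<longrightarrow> length p' \<le> length p)"
    by (rule ex_has_greatest_nat[of ?P q length "Suc (card V)"]) (use q bound in \<open>auto simp: less_Suc_eq_le\<close>)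
  then obtain p where p: "?P p" and longest: "\<And>p'. ?P p' \<Longrightarrow> length p' \<le> length p"
    by blast
  have len: "length p \<ge> 2" using longest[of q] q \<open>length q \<ge> 2\<close> by simp
  then obtain w p' where w: "p = p' @ [w]" by (cases p rule: rev_cases) auto
  with len obtain u p0 where "p' = p0 @ [u]" by (cases p' rule: rev_cases) auto
  with w have pw: "p = p0 @ [u, w]" by simp
  from p pw have on: "path_on V E (p0 @ [u, w])" "hd (p0 @ [u, w]) = r" by simp_all
  have V: "u \<in> V" "w \<in> V" "u \<noteq> w" "{u, w} \<in> E" and w0: "w \<notin> set p0"
    using on(1) unfolding path_on_def by (auto simp: successively_append_iff)
  have "w \<noteq> r" using on(2) w0 V(3) by (cases p0) auto
  moreover have "x = u" if e: "{x, w} \<in> E" for x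
  proof (rule ccontr)
    assume xu: "x \<noteq> u"
    have xw: "x \<noteq> w" and x: "x \<in> V" using sg e unfolding simple_graph_def by fastforce+
    have "x \<in> set p"
    proof (rule ccontr)
      assume "x \<notin> set p"
      with p x e pw have "path_on V E (p @ [x])"
        by (intro path_on_append) (simp_all add: path_on_def insert_commute)
      moreover have "hd (p @ [x]) = r" using p unfolding path_on_def by simp
      ultimately have "?P (p @ [x])" by blast
      then show False using longest by fastforce
    qed
    with pw xu xw have "x \<in> set p0" by simp
    then obtain p1 p2 where p0: "p0 = p1 @ x # p2" by (meson split_list)
    have "cycle_in V E (x # p2 @ [u, w])"
      using on(1) e unfolding p0 cycle_in_def path_on_def
      by (auto simp: successively_append_iff insert_commute)
    with acyc show False by blast
  qed
  ultimately show thesis using that V unfolding leaf_at_def by blast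
qed

lemma tree_remove_leaf:
  assumes "tree V E" "u \<in> V" "w \<in> V" "leaf_at E u w"
  shows "tree (V - {w}) (E - {{u, w}})"
proof -
  let ?V = "V - {w}" and ?E = "E - {{u, w}}"
  have sg: "simple_graph V E" and conn: "connected_graph V E"
    and acyc: "\<And>c. \<not> cycle_in V E c"
    using assms(1) unfolding tree_def connected_graph_def by blast+
  have leaf: "\<And>x. {x, w} \<in> E \<Longrightarrow> x = u" and uw: "u \<noteq> w"
    using assms(4) unfolding leaf_at_def by blast+
  have "simple_graph ?V ?E"
    unfolding simple_graph_def
  proof (intro conjI ballI)
    show "finite ?V" using sg unfolding simple_graph_def by blast
    fix e assume e: "e \<in> ?E"
    then have "e \<subseteq> V" "card e = 2" using sg unfolding simple_graph_def by auto
    moreover have "w \<notin> e"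
    proof
      assume "w \<in> e"
      with \<open>card e = 2\<close> obtain x where "e = {x, w}" by (auto simp: card_2_iff)
      with leaf e show False by auto
    qed
    ultimately show "e \<subseteq> ?V" "card e = 2" by auto
  qed
  moreover have "\<exists>p. path_between ?V ?E x p y" if "x \<in> ?V" "y \<in> ?V" for x y
  proof -
    from that conn obtain p where p: "path_between V E x p y"
      unfolding connected_graph_def by blast
    have "w \<notin> set p"
    proof
      assume "w \<in> set p"
      then obtain p1 p2 where w: "p = p1 @ w # p2" by (meson split_list)
      with p that have "p1 \<noteq> []" "p2 \<noteq> []" unfolding path_between_def by auto
      \<comment> \<open>Inside a path a vertex has two neighbours, but the leaf has one.\<close>
      with w p have "{last p1, w} \<in> E" "{hd p2, w} \<in> E"
        unfolding path_between_def by (auto simp: successively_append_iff successively_Cons insert_commute)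
      then have "last p1 = u" "hd p2 = u" by (auto intro: leaf)
      then have "u \<in> set p1 \<inter> set p2"
        using last_in_set[OF \<open>p1 \<noteq> []\<close>] hd_in_set[OF \<open>p2 \<noteq> []\<close>] by simp
      with w p show False unfolding path_between_def by auto
    qed
    then have "successively (\<lambda>x y. {x, y} \<in> ?E) p"
      using p unfolding path_between_def by (auto elim!: successively_mono simp: doubleton_eq_iff)
    with p \<open>w \<notin> set p\<close> have "path_between ?V ?E x p y" unfolding path_between_def by auto
    then show ?thesis by blast
  qed
  moreover have "\<not> cycle_in ?V ?E c" for c
  proof
    assume "cycle_in ?V ?E c"
    then have "cycle_in V E c" unfolding cycle_in_def by (auto elim: successively_mono)
    with acyc show False by blast
  qed
  ultimately show ?thesis using assms(2) uw unfolding tree_def connected_graph_def by blast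
qed

lemma tree_represented:
  assumes "tree V E" "r \<in> V"
  shows "\<exists>F. represents r F V E"
  using assms
proof (induction "card V" arbitrary: V E rule: less_induct)
  case less
  have sg: "simple_graph V E" using less.prems unfolding tree_def connected_graph_def by blast
  show ?case
  proof (cases "V = {r}")
    case True
    have "E = {}"
    proof (rule ccontr)
      assume "E \<noteq> {}"
      then obtain e where "e \<subseteq> {r}" "card e = 2" using sg True unfolding simple_graph_def by blast
      then show False using card_mono[of "{r}" e] by simp
    qed
    with True show ?thesis using represents.single[of r] by auto
  next
    case False
    with less.prems obtain u w where uw: "u \<in> V" "w \<in> V" "w \<noteq> r" "leaf_at E u w"
      by (rule tree_has_leaf)
    have "card (V - {w}) < card V"
      using uw(2) sg unfolding simple_graph_def by (intro psubset_card_mono) auto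
    from less.hyps[OF this tree_remove_leaf[OF less.prems(1) uw(1,2,4)]] less.prems(2) uw(3)
    obtain F where F: "represents r F (V - {w}) (E - {{u, w}})" by blast
    have "u \<noteq> w" "{u, w} \<in> E" using uw(4) unfolding leaf_at_def by blast+
    with represents_add_leaf[OF F, of u w] uw(1,2) show ?thesis by (simp add: insert_absorb)
  qed
qed

section \<open>Irregular trees as irregular forests\<close>

definition irregular_forest :: "forest \<Rightarrow> bool" where
  "irregular_forest F \<longleftrightarrow> width F \<le> 3 \<and> narrow F \<and>
    distinct (0 # vals (1 + order F) 0 F) \<and> distinct (evals (1 + order F) 0 F)"

lemma irregular_forest_iff:
  assumes "represents r F V E"
  shows "irregular_forest F \<longleftrightarrow>
    subcubic_tree V E \<and> transmission_irregular V E \<and> edge_transmission_irregular V E"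
  unfolding irregular_forest_def represents_subcubic[OF assms] irregular_iff_distinct[OF assms] by blast

lemma irregular_forest_realized:
  assumes "irregular_forest F"
  shows "\<exists>(V :: nat set) E. subcubic_tree V E \<and> card V = Suc (size F) \<and>
    transmission_irregular V E \<and> edge_transmission_irregular V E"
proof -
  obtain V E where F: "represents (0::nat) F V E" and "V = {0..0 + size F}"
    using represents_exists by blast
  then have "card V = Suc (size F)" by simp
  with assms irregular_forest_iff[OF F] show ?thesis by blast
qed

text \<open>Rooting at the vertex of least transmission makes all other vertices have a positive relative
  transmission, which bounds the sizes of the subtrees at the root.\<close>

lemma irregular_tree_centred:
  assumes "subcubic_tree V E" "transmission_irregular V E" "edge_transmission_irregular V E"
  obtains F where "irregular_forest F" "card V = Suc (size F)"
    "\<forall>y\<in>set (vals (1 + order F) 0 F). 0 < y"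
proof -
  have t: "tree V E" "finite V" "V \<noteq> {}"
    using assms(1) unfolding subcubic_tree_def tree_def connected_graph_def simple_graph_def by auto
  then obtain r where r: "r \<in> V" and least: "\<And>x. x \<in> V \<Longrightarrow> transmission V E r \<le> transmission V E x"
    using ex_min_if_finite[of "transmission V E ` V"] by (metis arg_min_if_finite(1) arg_min_least)
  obtain F where F: "represents r F V E" using tree_represented[OF t(1) r] by blast
  have irr: "irregular_forest F" using irregular_forest_iff[OF F] assms by blast
  have n: "int (card V) = 1 + order F" using represents_graph[OF F] by blast
  let ?t = "int (transmission V E r)"
  have "0 < y" if y: "y \<in> set (vals (1 + order F) 0 F)" for y
  proof -
    have "?t + y \<in> set (vals (1 + order F) (?t + 0) F)" unfolding vals_shift using y by simp
    then have "?t + y \<in># image_mset (pull V E 0 r) (mset_set V)"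
      using mset_pull[OF F, of 0] n by simp
    then obtain x where "x \<in> V" "?t + y = int (transmission V E x)"
      using t(2) by (auto simp: pull_def)
    with least[of x] have "0 \<le> y" by simp
    moreover have "y \<noteq> 0" using irr y unfolding irregular_forest_def by auto
    ultimately show ?thesis by simp
  qed
  then show thesis using that[OF irr] n by (simp add: order_size)
qed

section \<open>The orders without irregular trees\<close>

fun tree_orders :: "forest \<Rightarrow> int list" where
  "tree_orders Void = []"
| "tree_orders (Plant c s) = (1 + order c) # tree_orders s"

lemma tree_orders_le: "t \<in> set (tree_orders F) \<Longrightarrow> t \<le> order F"
proof (induction F)
  case (Plant c s)
  then show ?case using order_size[of c] order_size[of s] by auto
qed simp

lemma vals_tree_orders: "t \<in> set (tree_orders F) \<Longrightarrow> x + n - 2 * t \<in> set (vals n x F)"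
  by (induction F) (auto simp: Let_def)

text \<open>All narrow forests with \<open>m\<close> vertices, at most \<open>w\<close> trees and at most \<open>b\<close> vertices in each tree,
  in which siblings carry subtrees of distinct sizes; equal sizes would give two siblings the same
  transmission. The index \<open>i\<close> is the order of the forest below the first root, hence one less than
  the order of the first tree.\<close>

fun forests :: "nat \<Rightarrow> nat \<Rightarrow> nat \<Rightarrow> forest list" where
  "forests b w 0 = [Void]"
| "forests b 0 (Suc m) = []"
| "forests b (Suc w) (Suc m) = concat (map (\<lambda>i.
    concat (map (\<lambda>c. map (Plant c)
        (filter (\<lambda>s. 1 + order c \<notin> set (tree_orders s)) (forests b w (m - i)))) (forests b 2 i)))
    [0..<min b (Suc m)])"

lemma forests_complete:
  assumes "width F \<le> w" "narrow F" "\<forall>t\<in>set (tree_orders F). t \<le> int b" "distinct (vals n x F)"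
  shows "F \<in> set (forests b w (size F))"
  using assms
proof (induction F arbitrary: w x)
  case Void
  show ?case by simp
next
  case (Plant c s)
  then obtain w' where w: "w = Suc w'" "width s \<le> w'" by (cases w) auto
  let ?y = "x + n - 2 * (1 + order c)"
  have dist: "distinct (vals n ?y c)" "distinct (vals n x s)" "?y \<notin> set (vals n x s)"
    using Plant.prems(4) by (auto simp: Let_def)
  have c: "1 + order c \<le> int b" using Plant.prems(3) by simp
  then have "c \<in> set (forests b 2 (size c))"
    using Plant.prems(2) tree_orders_le[of _ c] dist(1) by (intro Plant.IH(1)) force+
  moreover have "s \<in> set (forests b w' (size s))"
    using Plant.prems(2,3) w(2) dist(2) by (intro Plant.IH(2)) auto
  moreover have "1 + order c \<notin> set (tree_orders s)" using vals_tree_orders dist(3) by blast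
  moreover have "size c < b" using c by (simp add: order_size)
  ultimately show ?case unfolding w by (force intro!: bexI[of _ "size c"] bexI[of _ c])
qed

definition no_irregular :: "nat \<Rightarrow> bool" where
  "no_irregular n \<longleftrightarrow> list_all (\<lambda>F. \<not> (distinct (0 # vals (1 + order F) 0 F) \<and>
    distinct (evals (1 + order F) 0 F))) (forests ((n - 1) div 2) 3 (n - 1))"

lemma no_irregular_tree:
  assumes "no_irregular n" "n \<ge> 2" "subcubic_tree V E" "card V = n" "transmission_irregular V E"
  shows "\<not> edge_transmission_irregular V E"
proof
  assume "edge_transmission_irregular V E"
  from irregular_tree_centred[OF assms(3,5) this] obtain F where
    F: "irregular_forest F" "card V = Suc (size F)" "\<forall>y\<in>set (vals (1 + order F) 0 F). 0 < y" .
  have n: "size F = n - 1" using F(2) assms(2,4) by simp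
  have "t \<le> int ((n - 1) div 2)" if "t \<in> set (tree_orders F)" for t
  proof -
    have "0 < 0 + (1 + order F) - 2 * t" using vals_tree_orders[OF that] F(3) by blast
    then show ?thesis using n assms(2) by (simp add: order_size)
  qed
  then have "F \<in> set (forests ((n - 1) div 2) 3 (size F))"
    using F(1) unfolding irregular_forest_def by (intro forests_complete) auto
  then show False using F(1) assms(1)
    unfolding no_irregular_def irregular_forest_def list_all_iff n by blast
qed

text \<open>For \<open>n = 14\<close>, the largest case, the root carries subtrees of sizes 6, 5, 2 or 6, 4, 3. Over
  all ten orders together, fewer than a thousand ordered shapes are inspected.\<close>

lemma excluded_orders: "list_all no_irregular [2, 3, 4, 5, 6, 7, 8, 10, 12, 14]"
  by code_simp

section \<open>Trees with three legs\<close>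

fun beside :: "forest \<Rightarrow> forest \<Rightarrow> forest" where
  "beside Void G = G"
| "beside (Plant c s) G = Plant c (beside s G)"

lemma beside_simps [simp]:
  "order (beside F G) = order F + order G"
  "width (beside F G) = width F + width G"
  "narrow (beside F G) \<longleftrightarrow> narrow F \<and> narrow G"
  "vals n x (beside F G) = vals n x F @ vals n x G"
  "evals n x (beside F G) = evals n x F @ evals n x G"
  by (induction F) (simp_all add: Let_def)

fun path :: "nat \<Rightarrow> forest" where
  "path 0 = Void"
| "path (Suc k) = Plant (path k) Void"

text \<open>A spine with one vertex for each entry of the list; the entry is the number of vertices of
  a further path that hangs from that vertex, in addition to the rest of the spine.\<close>

fun leg :: "nat list \<Rightarrow> forest" where
  "leg [] = Void"
| "leg (h # hs) = Plant (beside (path h) (leg hs)) Void"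

definition tripod :: "nat list \<Rightarrow> nat list \<Rightarrow> nat list \<Rightarrow> forest" where
  "tripod as bs cs = beside (leg as) (beside (leg bs) (leg cs))"

lemma leg_replicate: "leg (replicate k 0) = path k"
  by (induction k) simp_all

lemma path_shape [simp]: "order (path k) = int k" "width (path k) \<le> 1" "narrow (path k)"
proof (induction k)
  case (Suc k)
  { case 1 show ?case using Suc by simp }
  { case 2 show ?case by simp }
  { case 3 show ?case using Suc by simp }
qed simp_all

text \<open>The sizes of the subtrees along a path are \<open>k, k - 1, ...\<close>, so that the increments grow by 2 at each
  step and the transmissions are a quadratic polynomial in the position. Positions are counted from
  \<open>d\<close>, since the path may continue a leg whose first \<open>d - 1\<close> vertices are treated separately.\<close>

lemma vals_path:
  assumes "\<And>u. g u = x + (int u - int d + 1) * (n - 2 * int k) + (int u - int d + 1) * (int u - int d)"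
  shows "vals n x (path k) = map g [d..<d + k]"
  using assms
proof (induction k arbitrary: x d)
  case (Suc k)
  let ?y = "x + n - 2 * (1 + int k)"
  have "vals n ?y (path k) = map g [Suc d..<Suc d + k]"
    by (rule Suc.IH) (simp add: Suc.prems algebra_simps)
  moreover have "[d..<d + Suc k] = d # [Suc d..<Suc d + k]" by (simp add: upt_conv_Cons del: upt_Suc)
  ultimately show ?case by (simp add: Let_def Suc.prems algebra_simps del: upt_Suc)
qed simp

lemma evals_path:
  assumes "\<And>u. g u = 2 * x + (2 * (int u - int d) + 1) * (n - 2 * int k) + 2 * (int u - int d)\<^sup>2"
  shows "evals n x (path k) = map g [d..<d + k]"
  using assms
proof (induction k arbitrary: x d)
  case (Suc k)
  let ?y = "x + n - 2 * (1 + int k)"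
  have "evals n ?y (path k) = map g [Suc d..<Suc d + k]"
    by (rule Suc.IH) (simp add: Suc.prems algebra_simps power2_eq_square)
  moreover have "[d..<d + Suc k] = d # [Suc d..<Suc d + k]" by (simp add: upt_conv_Cons del: upt_Suc)
  ultimately show ?case by (simp add: Let_def Suc.prems algebra_simps del: upt_Suc)
qed simp

text \<open>The criterion behind all three families. The sequences form one increasing chain
  \<open>a 2 < b 2 < c 2 < a 3 < b 3 < ...\<close>; the exceptional values in \<open>low\<close> lie below the chain, and those
  in \<open>gaps\<close> between two consecutive members of it, at a stated position \<open>t\<close>. The chain starts at 2
  because leaves hung on the first vertex of a leg can make that vertex deviate from the polynomial.\<close>

lemma distinct_interleaved:
  fixes a b c :: "nat \<Rightarrow> int"
  assumes step: "\<And>u. 2 \<le> u \<Longrightarrow> a u < b u \<and> b u < c u \<and> c u < a (Suc u)"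
    and lists: "A = map a [i..<i']" "B = map b [j..<j']" "C = map c [k..<k']"
    and start: "2 \<le> i" "2 \<le> j" "2 \<le> k"
    and low: "\<forall>e\<in>set low. e < a 2"
    and gaps: "\<forall>(t, e)\<in>set gaps. 2 \<le> t \<and> (a t < e \<and> e < b t \<or> c t < e \<and> e < a (Suc t))"
    and dist: "distinct (low @ map snd gaps)"
  shows "distinct (low @ map snd gaps @ A @ B @ C)"
proof -
  have later: "c u < a w" if "2 \<le> u" "u < w" for u w
    using that(2)
  proof (induction w)
    case (Suc w)
    then consider "u = w" | "u < w" by linarith
    then show ?case
    proof cases
      case 1
      then show ?thesis using step[of w] that(1) by simp
    next
      case 2
      then show ?thesis using Suc.IH step[of w] that(1) by simp
    qed
  qed simp
  have ne: "a u \<noteq> b w" "b u \<noteq> c w" "a u \<noteq> c w" if "2 \<le> u" "2 \<le> w" for u w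
    using step[OF that(1)] step[OF that(2)] later[of u w] later[of w u] that
    by (cases u w rule: linorder_cases; simp)+
  have less: "x u < x w" if "2 \<le> u" "u < w" "x = a \<or> x = b \<or> x = c" for u w x
    using step[OF that(1)] step[of w] later[of u w] that by auto
  have inj: "inj_on x {l..<l'}" if "2 \<le> l" "x = a \<or> x = b \<or> x = c" for x l l'
  proof (rule inj_onI, rule ccontr)
    fix u w assume "u \<in> {l..<l'}" "w \<in> {l..<l'}" "x u = x w" "u \<noteq> w"
    then show False using less[of u w x] less[of w u x] that by (cases u w rule: linorder_cases) auto
  qed
  let ?es = "low @ map snd gaps"
  have es: "e < a 2 \<or> (\<exists>t\<ge>2. a t < e \<and> e < b t \<or> c t < e \<and> e < a (Suc t))" if "e \<in> set ?es" for e
    using that low gaps by fastforce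
  have gap: "e \<noteq> a u \<and> e \<noteq> b u \<and> e \<noteq> c u" if "e \<in> set ?es" "2 \<le> u" for e u
    using es[OF that(1)]
  proof (elim disjE exE conjE)
    assume "e < a 2"
    then show ?thesis using step[OF that(2)] step[of 2] later[of 2 u] that(2)
      by (cases "u = 2") auto
  next
    fix t assume t: "2 \<le> t" "a t < e" "e < b t"
    then show ?thesis using step[OF that(2)] step[OF t(1)] later[of t u] later[of u t] that(2)
      by (cases u t rule: linorder_cases) auto
  next
    fix t assume t: "2 \<le> t" "c t < e" "e < a (Suc t)"
    consider "u < t" | "u = t" | "u = Suc t" | "Suc t < u" by linarith
    then show ?thesis
    proof cases
      case 1
      then show ?thesis using t step[OF that(2)] step[OF t(1)] later[of u t] that(2) by simp
    next
      case 2
      then show ?thesis using t step[OF that(2)] by simp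
    next
      case 3
      then show ?thesis using t step[OF that(2)] by simp
    next
      case 4
      then show ?thesis using t step[OF that(2)] step[of "Suc t"] later[of "Suc t" u] by simp
    qed
  qed
  have "distinct A" "distinct B" "distinct C"
    unfolding lists using inj start by (simp_all add: distinct_map)
  moreover have sets: "set A \<subseteq> a ` {2..}" "set B \<subseteq> b ` {2..}" "set C \<subseteq> c ` {2..}"
    unfolding lists using start by auto
  moreover have "a ` {2..} \<inter> b ` {2..} = {}" "b ` {2..} \<inter> c ` {2..} = {}" "a ` {2..} \<inter> c ` {2..} = {}"
    using ne by auto
  with sets have "set A \<inter> set B = {}" "set B \<inter> set C = {}" "set A \<inter> set C = {}" by blast+
  moreover have "set ?es \<inter> (a ` {2..} \<union> b ` {2..} \<union> c ` {2..}) = {}" using gap by auto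
  with sets have "set ?es \<inter> (set A \<union> set B \<union> set C) = {}" by blast
  ultimately show ?thesis using dist by (auto simp: Int_Un_distrib)
qed

section \<open>Three families of irregular trees\<close>

text \<open>The three families have orders \<open>3 m + 4\<close>, \<open>3 m + 6\<close> and \<open>3 m + 8\<close>; an entry 1 of a list stands
  for a hung leaf.\<close>

definition tripod1 :: "nat \<Rightarrow> forest" where
  "tripod1 m = tripod (1 # replicate m 0) (replicate (m + 1) 0) (replicate m 0)"

definition tripod0 :: "nat \<Rightarrow> forest" where
  "tripod0 m = tripod (1 # 1 # replicate (m - 1) 0) (1 # replicate m 0) (replicate m 0)"

definition tripod2 :: "nat \<Rightarrow> forest" where
  "tripod2 m = tripod (1 # 1 # replicate m 0) (replicate (m + 2) 0) (replicate (m + 1) 0)"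

lemma tripod_orders:
  "order (tripod1 m) = 3 * int m + 3"
  "0 < m \<Longrightarrow> order (tripod0 m) = 3 * int m + 5"
  "order (tripod2 m) = 3 * int m + 7"
  unfolding tripod1_def tripod0_def tripod2_def tripod_def leg_replicate by (simp_all add: leg_replicate)

text \<open>The polynomials \<open>?a\<close>, \<open>?b\<close>, \<open>?c\<close> in the following proofs give the transmissions,
  relative to the root, of the \<open>u\<close>-th vertices of the three legs and of the edges leading to them,
  for \<open>u \<ge> 2\<close> up to the exceptions listed among the gaps. The steps from \<open>?c u\<close> to
  \<open>?a (u + 1)\<close> equal \<open>M\<close> and \<open>2 * M\<close> here, and \<open>M - 2\<close> and \<open>2 * M - 4\<close> for the other two families.
  The leaf on the first leg needs \<open>?c 3 < 4 * M + 2\<close>, which holds from \<open>M = 17\<close> on; the bounds on \<open>m\<close>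
  for the other families arise in the same way, from \<open>?c 4\<close> and the leaf on the second vertex of
  the first leg.\<close>

lemma tripod1_irregular:
  assumes "17 \<le> m"
  shows "irregular_forest (tripod1 m)" (is "irregular_forest ?F")
proof -
  obtain k where m: "m = Suc k" using assms by (cases m) auto
  define M n where "M = int m" and "n = 3 * M + 4"
  have M: "17 \<le> M" and k: "int k = M - 1" using assms by (simp_all add: M_def m)
  have F: "?F = beside (Plant (Plant Void (path m)) Void)
      (beside (Plant (path m) Void) (Plant (path k) Void))"
    unfolding tripod1_def tripod_def leg_replicate by (simp add: leg_replicate m)
  have order: "1 + order ?F = n" unfolding F by (simp add: M_def n_def m)
  have "width ?F \<le> 3" "narrow ?F"
    unfolding F using path_shape(2)[of m] path_shape(2)[of k] by simp_all
  moreover have "distinct ([0, M, M + 2, M + 4] @ map snd [(3 :: nat, 4 * M + 2)] @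
      vals n M (path m) @ vals n (M + 2) (path m) @ vals n (M + 4) (path k))"
  proof (rule distinct_interleaved)
    let ?a = "\<lambda>u. int u * M + int u * int u + int u - 2"
    let ?b = "\<lambda>u. int u * M + int u * int u + int u"
    let ?c = "\<lambda>u. int u * M + int u * int u + 3 * int u"
    show "vals n M (path m) = map ?a [2..<2 + m]"
      "vals n (M + 2) (path m) = map ?b [2..<2 + m]"
      "vals n (M + 4) (path k) = map ?c [2..<2 + k]"
      by (rule vals_path, simp add: n_def k M_def[symmetric] algebra_simps)+
    show "?a u < ?b u \<and> ?b u < ?c u \<and> ?c u < ?a (Suc u)" if "2 \<le> u" for u
      using that M by (simp add: algebra_simps)
  qed (use M in auto)
  then have "distinct (0 # vals n 0 ?F)"
    unfolding F by (simp add: Let_def n_def M_def m algebra_simps)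
  moreover have "distinct ([M, M + 2, M + 4] @ map snd [(2 :: nat, 5 * M + 2)] @
      evals n M (path m) @ evals n (M + 2) (path m) @ evals n (M + 4) (path k))"
  proof (rule distinct_interleaved)
    let ?a = "\<lambda>u. (2 * int u - 1) * M + 2 * int u * int u - 4"
    let ?b = "\<lambda>u. (2 * int u - 1) * M + 2 * int u * int u"
    let ?c = "\<lambda>u. (2 * int u - 1) * M + 2 * int u * int u + 4 * int u - 2"
    show "evals n M (path m) = map ?a [2..<2 + m]"
      "evals n (M + 2) (path m) = map ?b [2..<2 + m]"
      "evals n (M + 4) (path k) = map ?c [2..<2 + k]"
      by (rule evals_path, simp add: n_def k M_def[symmetric] algebra_simps power2_eq_square)+
    show "?a u < ?b u \<and> ?b u < ?c u \<and> ?c u < ?a (Suc u)" if "2 \<le> u" for u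
      using that M by (simp add: algebra_simps)
  qed (use M in auto)
  then have "distinct (evals n 0 ?F)"
    unfolding F by (simp add: Let_def n_def M_def m algebra_simps)
  ultimately show ?thesis unfolding irregular_forest_def order by blast
qed

text \<open>With two leaves on the first leg, its second vertex follows the polynomial, whereas the edge above
  it exceeds \<open>?a 2\<close> by 2 and is listed among the gaps.\<close>

lemma tripod0_irregular:
  assumes "29 \<le> m"
  shows "irregular_forest (tripod0 m)" (is "irregular_forest ?F")
proof -
  obtain k where m: "m = Suc k" using assms by (cases m) auto
  define M n where "M = int m" and "n = 3 * M + 6"
  have M: "29 \<le> M" and k: "int k = M - 1" using assms by (simp_all add: M_def m)
  have F: "?F = beside (Plant (Plant Void (Plant (Plant Void (path k)) Void)) Void)
      (beside (Plant (Plant Void (path m)) Void) (Plant (path k) Void))"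
    unfolding tripod0_def tripod_def leg_replicate by (simp add: leg_replicate m)
  have order: "1 + order ?F = n" unfolding F by (simp add: M_def n_def m)
  have "width ?F \<le> 3" "narrow ?F"
    unfolding F using path_shape(2)[of m] path_shape(2)[of k] by simp_all
  moreover have "distinct ([0, M, M + 2, M + 6] @
      map snd [(3 :: nat, 4 * M + 4), (3, 4 * M + 6), (4, 5 * M + 8)] @
      ((2 * M + 4) # vals n (2 * M + 4) (path k)) @ vals n (M + 2) (path m) @ vals n (M + 6) (path k))"
  proof (rule distinct_interleaved)
    let ?a = "\<lambda>u. int u * M + int u * int u + 3 * int u - 6"
    let ?b = "\<lambda>u. int u * M + int u * int u + 3 * int u - 2"
    let ?c = "\<lambda>u. int u * M + int u * int u + 5 * int u"
    have "vals n (2 * M + 4) (path k) = map ?a [3..<3 + k]"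
      by (rule vals_path, simp add: n_def k algebra_simps)
    moreover have "[2..<3 + k] = 2 # [3..<3 + k]" by (simp add: upt_conv_Cons del: upt_Suc)
    ultimately show "(2 * M + 4) # vals n (2 * M + 4) (path k) = map ?a [2..<3 + k]" by simp
    show "vals n (M + 2) (path m) = map ?b [2..<2 + m]"
      "vals n (M + 6) (path k) = map ?c [2..<2 + k]"
      by (rule vals_path, simp add: n_def k M_def[symmetric] algebra_simps)+
    show "?a u < ?b u \<and> ?b u < ?c u \<and> ?c u < ?a (Suc u)" if "2 \<le> u" for u
      using that M by (simp add: algebra_simps)
  qed (use M in auto)
  then have "distinct (0 # vals n 0 ?F)"
    unfolding F by (simp add: Let_def n_def M_def m algebra_simps)
  moreover have "distinct ([M, M + 2, M + 6] @
      map snd [(2 :: nat, 3 * M + 4), (2, 5 * M + 4), (2, 5 * M + 8), (3, 7 * M + 12)] @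
      evals n (2 * M + 4) (path k) @ evals n (M + 2) (path m) @ evals n (M + 6) (path k))"
  proof (rule distinct_interleaved)
    let ?a = "\<lambda>u. (2 * int u - 1) * M + 2 * int u * int u + 4 * int u - 14"
    let ?b = "\<lambda>u. (2 * int u - 1) * M + 2 * int u * int u + 4 * int u - 6"
    let ?c = "\<lambda>u. (2 * int u - 1) * M + 2 * int u * int u + 8 * int u - 4"
    show "evals n (2 * M + 4) (path k) = map ?a [3..<3 + k]"
      "evals n (M + 2) (path m) = map ?b [2..<2 + m]"
      "evals n (M + 6) (path k) = map ?c [2..<2 + k]"
      by (rule evals_path, simp add: n_def k M_def[symmetric] algebra_simps power2_eq_square)+
    show "?a u < ?b u \<and> ?b u < ?c u \<and> ?c u < ?a (Suc u)" if "2 \<le> u" for u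
      using that M by (simp add: algebra_simps)
  qed (use M in auto)
  then have "distinct (evals n 0 ?F)"
    unfolding F by (simp add: Let_def n_def M_def m algebra_simps)
  ultimately show ?thesis unfolding irregular_forest_def order by blast
qed

lemma tripod2_irregular:
  assumes "27 \<le> m"
  shows "irregular_forest (tripod2 m)" (is "irregular_forest ?F")
proof -
  define M n where "M = int m" and "n = 3 * M + 8"
  have M: "27 \<le> M" using assms by (simp add: M_def)
  have F: "?F = beside (Plant (Plant Void (Plant (Plant Void (path m)) Void)) Void)
      (beside (Plant (path (Suc m)) Void) (Plant (path m) Void))"
    unfolding tripod2_def tripod_def leg_replicate by (simp add: leg_replicate)
  have order: "1 + order ?F = n" unfolding F by (simp add: M_def n_def)
  have "width ?F \<le> 3" "narrow ?F"
    unfolding F using path_shape(2)[of m] by simp_all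
  moreover have "distinct ([0, M, M + 4, M + 6] @ map snd [(3 :: nat, 4 * M + 6), (4, 5 * M + 10)] @
      ((2 * M + 4) # vals n (2 * M + 4) (path m)) @ vals n (M + 4) (path (Suc m)) @ vals n (M + 6) (path m))"
  proof (rule distinct_interleaved)
    let ?a = "\<lambda>u. int u * M + int u * int u + 3 * int u - 6"
    let ?b = "\<lambda>u. int u * M + int u * int u + 3 * int u"
    let ?c = "\<lambda>u. int u * M + int u * int u + 5 * int u"
    have "vals n (2 * M + 4) (path m) = map ?a [3..<3 + m]"
      by (rule vals_path, simp add: n_def M_def[symmetric] algebra_simps)
    moreover have "[2..<3 + m] = 2 # [3..<3 + m]" by (simp add: upt_conv_Cons del: upt_Suc)
    ultimately show "(2 * M + 4) # vals n (2 * M + 4) (path m) = map ?a [2..<3 + m]" by simp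
    show "vals n (M + 4) (path (Suc m)) = map ?b [2..<2 + Suc m]"
      "vals n (M + 6) (path m) = map ?c [2..<2 + m]"
      by (rule vals_path, simp add: n_def M_def[symmetric] algebra_simps)+
    show "?a u < ?b u \<and> ?b u < ?c u \<and> ?c u < ?a (Suc u)" if "2 \<le> u" for u
      using that M by (simp add: algebra_simps)
  qed (use M in auto)
  then have "distinct (0 # vals n 0 ?F)"
    unfolding F by (simp add: Let_def n_def M_def algebra_simps)
  moreover have "distinct ([M, M + 4, M + 6] @
      map snd [(2 :: nat, 3 * M + 4), (2, 5 * M + 6), (3, 7 * M + 14)] @
      evals n (2 * M + 4) (path m) @ evals n (M + 4) (path (Suc m)) @ evals n (M + 6) (path m))"
  proof (rule distinct_interleaved)
    let ?a = "\<lambda>u. (2 * int u - 1) * M + 2 * int u * int u + 4 * int u - 14"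
    let ?b = "\<lambda>u. (2 * int u - 1) * M + 2 * int u * int u + 4 * int u - 2"
    let ?c = "\<lambda>u. (2 * int u - 1) * M + 2 * int u * int u + 8 * int u - 4"
    show "evals n (2 * M + 4) (path m) = map ?a [3..<3 + m]"
      "evals n (M + 4) (path (Suc m)) = map ?b [2..<2 + Suc m]"
      "evals n (M + 6) (path m) = map ?c [2..<2 + m]"
      by (rule evals_path, simp add: n_def M_def[symmetric] algebra_simps power2_eq_square)+
    show "?a u < ?b u \<and> ?b u < ?c u \<and> ?c u < ?a (Suc u)" if "2 \<le> u" for u
      using that M by (simp add: algebra_simps)
  qed (use M in auto)
  then have "distinct (evals n 0 ?F)"
    unfolding F by (simp add: Let_def n_def M_def algebra_simps)
  ultimately show ?thesis unfolding irregular_forest_def order by blast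
qed

section \<open>The remaining orders up to 90\<close>

text \<open>At these orders \<open>m\<close> is too small for its family: a leg degenerates or two values collide. The trees
  that are used instead come from a search.\<close>

definition sporadic :: "forest list" where
  "sporadic = [
    tripod (replicate 4 0) (replicate 3 0) (replicate 1 0),
    tripod (0 # 1 # replicate 2 0) (replicate 4 0) (replicate 1 0),
    tripod (0 # 1 # replicate 2 0) (replicate 4 0) (replicate 3 0),
    tripod (0 # 1 # replicate 4 0) (replicate 6 0) (replicate 1 0),
    tripod (0 # 1 # replicate 3 0) (0 # 1 # replicate 2 0) (replicate 4 0),
    tripod (3 # replicate 4 0) (0 # 1 # replicate 2 0) (replicate 4 0),
    tripod (0 # 0 # 0 # 1 # replicate 4 0) (replicate 8 0) (replicate 2 0),
    tripod (replicate 10 0) (replicate 9 0) (replicate 1 0),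
    tripod (1 # 1 # replicate 6 0) (replicate 8 0) (replicate 3 0),
    tripod (1 # replicate 9 0) (replicate 10 0) (replicate 2 0),
    tripod (replicate 8 0 @ 1 # replicate 2 0) (0 # 4 # replicate 5 0) (replicate 2 0),
    tripod (replicate 13 0) (replicate 12 0) (replicate 2 0),
    tripod (replicate 14 0) (replicate 13 0) (replicate 1 0),
    tripod (0 # 1 # replicate 11 0) (0 # 1 # replicate 10 0) (replicate 2 0),
    tripod (replicate 14 0) (replicate 13 0) (1 # replicate 4 0),
    tripod (1 # replicate 15 0) (replicate 16 0) (replicate 2 0),
    tripod (replicate 20 0) (replicate 19 0) (replicate 2 0),
    tripod (replicate 19 0) (replicate 18 0) (1 # replicate 4 0),
    tripod (replicate 22 0) (replicate 21 0) (replicate 1 0),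
    tripod (1 # replicate 21 0) (replicate 22 0) (replicate 2 0),
    tripod (replicate 25 0) (replicate 24 0) (replicate 2 0),
    tripod (replicate 24 0) (replicate 23 0) (1 # replicate 10 0),
    tripod (replicate 30 0) (replicate 29 0) (replicate 2 0),
    tripod (replicate 32 0) (replicate 31 0) (replicate 2 0),
    tripod (replicate 42 0) (replicate 41 0) (replicate 2 0),
    tripod (replicate 44 0) (replicate 43 0) (replicate 2 0)]"

definition sporadic_orders :: "int list" where
  "sporadic_orders = [9, 11, 13, 15, 16, 18, 20, 21, 22, 24, 26, 28, 29, 30, 34, 36, 42, 44, 45, 48, 52, 60, 62, 66, 86, 90]"

lemma order_sporadic: "map (\<lambda>F. 1 + order F) sporadic = sporadic_orders"
  by code_simp

lemma sporadic_irregular: "list_all irregular_forest sporadic"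
  by code_simp

lemma tripod1_small:
  "list_all (\<lambda>m. 3 * int m + 4 \<in> set sporadic_orders \<or> irregular_forest (tripod1 m)) [4..<17]"
  by code_simp

lemma tripod0_small:
  "list_all (\<lambda>m. 3 * int m + 6 \<in> set sporadic_orders \<or> irregular_forest (tripod0 m)) [3..<29]"
  by code_simp

lemma tripod2_small:
  "list_all (\<lambda>m. 3 * int m + 8 \<in> set sporadic_orders \<or> irregular_forest (tripod2 m)) [3..<27]"
  by code_simp

section \<open>The characterization of the orders\<close>

lemma irregular_forest_of_order:
  assumes "n \<in> {9, 11, 13} \<or> n \<ge> 15"
  shows "\<exists>F. irregular_forest F \<and> 1 + order F = int n"
proof -
  have sporadic: ?thesis if "int n \<in> set sporadic_orders"
  proof -
    from that obtain F where "F \<in> set sporadic" "1 + order F = int n"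
      unfolding order_sporadic[symmetric] by auto
    then show ?thesis using sporadic_irregular unfolding list_all_iff by blast
  qed
  consider "n < 15" | m where "n = 3 * m + 4" "4 \<le> m" | m where "n = 3 * m + 6" "3 \<le> m"
    | m where "n = 3 * m + 8" "3 \<le> m"
  proof -
    have "n < 15 \<or> (\<exists>m\<ge>4. n = 3 * m + 4) \<or> (\<exists>m\<ge>3. n = 3 * m + 6) \<or> (\<exists>m\<ge>3. n = 3 * m + 8)"
      by presburger
    then show thesis using that by blast
  qed
  then show ?thesis
  proof cases
    case 1
    with assms show ?thesis by (intro sporadic) (auto simp: sporadic_orders_def)
  next
    case (2 m)
    have "int n \<in> set sporadic_orders \<or> irregular_forest (tripod1 m)"
    proof (cases "m < 17")
      case True
      then have "m \<in> set [4..<17]" using 2(2) by (simp only: set_upt atLeastLessThan_iff)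
      from bspec[OF tripod1_small[unfolded list_all_iff] this] show ?thesis using 2(1) by simp
    qed (use tripod1_irregular in auto)
    then show ?thesis using sporadic tripod_orders(1)[of m] 2(1) by auto
  next
    case (3 m)
    have "int n \<in> set sporadic_orders \<or> irregular_forest (tripod0 m)"
    proof (cases "m < 29")
      case True
      then have "m \<in> set [3..<29]" using 3(2) by (simp only: set_upt atLeastLessThan_iff)
      from bspec[OF tripod0_small[unfolded list_all_iff] this] show ?thesis using 3(1) by simp
    qed (use tripod0_irregular in auto)
    then show ?thesis using sporadic tripod_orders(2)[of m] 3 by auto
  next
    case (4 m)
    have "int n \<in> set sporadic_orders \<or> irregular_forest (tripod2 m)"
    proof (cases "m < 27")
      case True
      then have "m \<in> set [3..<27]" using 4(2) by (simp only: set_upt atLeastLessThan_iff)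
      from bspec[OF tripod2_small[unfolded list_all_iff] this] show ?thesis using 4(1) by simp
    qed (use tripod2_irregular in auto)
    then show ?thesis using sporadic tripod_orders(3)[of m] 4(1) by auto
  qed
qed

theorem theorem1p1:
  fixes n :: nat
  assumes "n \<ge> 2"
  shows "(\<exists>(V :: nat set) (E :: nat set set).
            subcubic_tree V E \<and> card V = n \<and>
            transmission_irregular V E \<and> edge_transmission_irregular V E)
         \<longleftrightarrow> n \<in> {9, 11, 13} \<or> n \<ge> 15"
    (is "?ex \<longleftrightarrow> ?orders")
proof
  assume ex: ?ex
  show ?orders
  proof (rule ccontr)
    assume "\<not> ?orders"
    then have "n \<in> {2, 3, 4, 5, 6, 7, 8, 10, 12, 14}" using assms by simp presburger
    with excluded_orders have "no_irregular n" by auto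
    with ex no_irregular_tree assms show False by blast
  qed
next
  assume ?orders
  then obtain F where F: "irregular_forest F" "1 + order F = int n"
    using irregular_forest_of_order by blast
  then have "Suc (size F) = n" by (simp add: order_size)
  with irregular_forest_realized[OF F(1)] show ?ex by auto
qed

end
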